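(* Let $X$ be a topological space. Then $\mathcal{M}_{\text{reg}}$, the assignment sending each open subset $U\subset X$ to the set $\mathcal{M}_{\text{reg}}(U)$ of regular Borel measures on $U$ together with restriction of measures, is a sub-presheaf of $\mathcal{M}$ on $X$, where $\mathcal{M}$ is the presheaf of Borel measures.
   Context: For an open subset $U\subset X$, $\mathcal{M}(U)$ is the set of Borel measures $\mu:\mathcal{B}(U)\to[0,\infty]$ and $\mathcal{M}_{\text{reg}}(U)\subset\mathcal{M}(U)$ is the subset of regular ones. A Borel measure $\mu$ on $U$ is regular if it is outer regular ($\mu(B)=\inf\{\mu(O):O\supset B\text{ open in }U\}$ for Borel $B$), inner regular ($\mu(B)=\sup\{\mu(K):K\subset B,\ K\text{ compact and Borel}\}$ for Borel $B$) and finite on compact (Borel) sets. For open $V\subset U$ the restriction $\mathcal{M}(U)\to\mathcal{M}(V)$ is $\mu\mapsto\mu|_V$, $\mu|_V(B)=\mu(B)$ for Borel $B\subset V$; the restriction maps of $\mathcal{M}_{\text{reg}}$ are those of $\mathcal{M}$. A presheaf of sets on $X$ is a contravariant functor from the poset of open subsets of $X$ (ordered by inclusion) to sets. A sub-presheaf $\mathcal{H}$ of a presheaf $\mathcal{F}$ is a presheaf with $\mathcal{H}(U)\subset\mathcal{F}(U)$ for all open $U$, such that the inclusions commute with the restriction maps. *)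

theory Defs
  imports "HOL-Analysis.Analysis"
begin

text \<open>
  A presheaf of sets has section sets \<open>F U\<close> and restriction maps \<open>res U V\<close> from \<open>F U\<close> to \<open>F V\<close>
  for opens \<open>V \<subseteq> U\<close>.  HOL functions are total, so the values of \<open>F\<close> and \<open>res\<close> elsewhere are
  irrelevant, and the functor laws are imposed on the section sets only.
\<close>

locale presheaf =
  fixes X :: "'a topology"
    and F :: "'a set \<Rightarrow> 'b set"
    and res :: "'a set \<Rightarrow> 'a set \<Rightarrow> 'b \<Rightarrow> 'b"
  assumes res_in:
      "\<lbrakk>openin X U; openin X V; V \<subseteq> U\<rbrakk> \<Longrightarrow> res U V \<in> F U \<rightarrow> F V"
    and res_id:
      "\<lbrakk>openin X U; s \<in> F U\<rbrakk> \<Longrightarrow> res U U s = s"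
    and res_comp:
      "\<lbrakk>openin X U; openin X V; openin X W; W \<subseteq> V; V \<subseteq> U; s \<in> F U\<rbrakk>
        \<Longrightarrow> res V W (res U V s) = res U W s"

locale sub_presheaf =
  sub: presheaf X H resH + ambient: presheaf X F resF
  for X :: "'a topology"
    and H :: "'a set \<Rightarrow> 'b set" and resH :: "'a set \<Rightarrow> 'a set \<Rightarrow> 'b \<Rightarrow> 'b"
    and F :: "'a set \<Rightarrow> 'b set" and resF :: "'a set \<Rightarrow> 'a set \<Rightarrow> 'b \<Rightarrow> 'b" +
  assumes sub_subset: "openin X U \<Longrightarrow> H U \<subseteq> F U"
    and incl_res:
      "\<lbrakk>openin X U; openin X V; V \<subseteq> U; s \<in> H U\<rbrakk> \<Longrightarrow> resH U V s = resF U V s"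

text \<open>
  Equality of the \<open>sets\<close> forces \<open>space \<mu> = topspace T\<close>.  Elements of the type \<open>measure\<close> are
  equal iff their spaces, sigma-algebras and values on measurable sets agree (\<open>emeasure\<close> is 0
  off \<open>sets\<close>), so they correspond exactly to measures on the Borel sigma-algebra of \<open>T\<close>.
\<close>

definition borel_measures_on :: "'a topology \<Rightarrow> 'a measure set" where
  "borel_measures_on T = {\<mu>. sets \<mu> = sigma_sets (topspace T) {W. openin T W}}"

text \<open>
  \<open>T\<close> need not be Hausdorff, so compact sets need not be Borel; only those that are enter below.
\<close>

definition regular_borel_measure :: "'a topology \<Rightarrow> 'a measure \<Rightarrow> bool" where
  "regular_borel_measure T \<mu> \<longleftrightarrow>
     \<mu> \<in> borel_measures_on T \<and>
     (\<forall>B\<in>sets \<mu>. emeasure \<mu> B = (INF W\<in>{W. openin T W \<and> B \<subseteq> W}. emeasure \<mu> W)) \<and>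
     (\<forall>B\<in>sets \<mu>. emeasure \<mu> B = (SUP K\<in>{K. compactin T K \<and> K \<in> sets \<mu> \<and> K \<subseteq> B}. emeasure \<mu> K)) \<and>
     (\<forall>K\<in>sets \<mu>. compactin T K \<longrightarrow> emeasure \<mu> K < \<infinity>)"

definition borel_measures :: "'a topology \<Rightarrow> 'a set \<Rightarrow> 'a measure set" where
  "borel_measures X U = borel_measures_on (subtopology X U)"

definition regular_borel_measures :: "'a topology \<Rightarrow> 'a set \<Rightarrow> 'a measure set" where
  "regular_borel_measures X U = {\<mu>. regular_borel_measure (subtopology X U) \<mu>}"

text \<open>
  The source \<open>U\<close> is recorded only for the shape of a presheaf restriction map; \<open>\<mu>\<close> already
  determines it.  For opens \<open>V \<subseteq> U\<close> the sets \<open>V \<inter> B\<close> with \<open>B\<close> Borel in \<open>U\<close>, which form the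
  sigma-algebra of \<open>restrict_space \<mu> V\<close>, are the Borel sets of \<open>V\<close>.
\<close>

definition measure_res :: "'a set \<Rightarrow> 'a set \<Rightarrow> 'a measure \<Rightarrow> 'a measure" where
  "measure_res U V \<mu> = restrict_space \<mu> V"

end

theory Submission
  imports Defs
begin

text \<open>An open subset V of U is itself Borel in U, so the Borel sets of V are exactly the Borel
  sets of U contained in V, and a measure and its restriction agree on them. Restriction therefore
  maps Borel measures to Borel measures and is functorial. The point with content is that it
  preserves regularity, which is \<open>regular_borel_measure_restrict_space\<close>: open supersets
  in U can be cut down to V, and compactness of a subset of V does not depend on whether it is
  tested in V or in U. The functor laws for regular measures are then those of the ambient
  presheaf.\<close>

lemma space_borel_measures_on:
  assumes "\<mu> \<in> borel_measures_on T"
  shows "space \<mu> = topspace T"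
proof -
  have "sets \<mu> = sets (sigma (topspace T) {W. openin T W})"
    using assms openin_subset
    by (subst sets_measure_of) (auto simp: borel_measures_on_def)
  from sets_eq_imp_space_eq[OF this] show ?thesis
    by (simp add: space_measure_of_conv)
qed

lemma openin_in_sets_borel_measures_on:
  assumes "\<mu> \<in> borel_measures_on T" "openin T V"
  shows "V \<in> sets \<mu>"
  using assms by (auto simp: borel_measures_on_def)

text \<open>Since V belongs to the sigma-algebra, taking traces on V commutes with generating a
  sigma-algebra, and the traces of open sets are the relatively open sets.\<close>

lemma restrict_space_borel_measures_on:
  assumes "\<mu> \<in> borel_measures_on T" "openin T V"
  shows "restrict_space \<mu> V \<in> borel_measures_on (subtopology T V)"
proof -
  have sub: "V \<subseteq> topspace T"
    using assms(2) by (rule openin_subset)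
  have opens: "{W. openin (subtopology T V) W} = (\<inter>) V ` {W. openin T W}"
    by (auto simp: openin_subtopology Int_commute)
  have "(\<inter>) V ` sigma_sets (topspace T) {W. openin T W}
      = sigma_sets V ((\<inter>) V ` {W. openin T W})"
    using assms(2) sub by (intro sigma_sets_Int) auto
  moreover have "topspace (subtopology T V) = V"
    using sub by auto
  ultimately show ?thesis
    using assms(1) by (simp add: borel_measures_on_def sets_restrict_space opens)
qed

text \<open>Openness of V is used twice: it makes V measurable, so that \<open>\<mu>\<close> and its
  restriction agree on subsets of V, and it places the restriction among the Borel measures of the
  subspace.\<close>

lemma regular_borel_measure_restrict_space:
  assumes reg: "regular_borel_measure T \<mu>" and V: "openin T V"
  shows "regular_borel_measure (subtopology T V) (restrict_space \<mu> V)"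
proof -
  let ?S = "subtopology T V" and ?\<nu> = "restrict_space \<mu> V"
  have \<mu>: "\<mu> \<in> borel_measures_on T"
    using reg by (simp add: regular_borel_measure_def)
  have V_sets: "V \<in> sets \<mu>" "V \<inter> space \<mu> \<in> sets \<mu>"
    using openin_in_sets_borel_measures_on[OF \<mu> V] by auto
  have sets_\<nu>: "B \<in> sets ?\<nu> \<longleftrightarrow> B \<subseteq> V \<and> B \<in> sets \<mu>" for B
    using sets_restrict_space_iff[OF V_sets(2)] .
  have em: "emeasure ?\<nu> B = emeasure \<mu> B" if "B \<subseteq> V" for B
    using emeasure_restrict_space[OF V_sets(2) that] .
  have outer: "emeasure ?\<nu> B = (INF W\<in>{W. openin ?S W \<and> B \<subseteq> W}. emeasure ?\<nu> W)"
    if B: "B \<in> sets ?\<nu>" for B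
  proof (rule antisym)
    show "emeasure ?\<nu> B \<le> (INF W\<in>{W. openin ?S W \<and> B \<subseteq> W}. emeasure ?\<nu> W)"
      using restrict_space_borel_measures_on[OF \<mu> V]
      by (auto intro!: INF_greatest emeasure_mono openin_in_sets_borel_measures_on)
    \<comment> \<open>An open superset W of B need not lie in V, but the smaller set
      \<open>W \<inter> V\<close> is relatively open and still contains B.\<close>
    have "(INF W\<in>{W. openin ?S W \<and> B \<subseteq> W}. emeasure ?\<nu> W) \<le> emeasure \<mu> W"
      if W: "openin T W" "B \<subseteq> W" for W
    proof (rule INF_lower2)
      show "W \<inter> V \<in> {W. openin ?S W \<and> B \<subseteq> W}"
        using W B by (auto simp: openin_subtopology_Int sets_\<nu>)
      show "emeasure ?\<nu> (W \<inter> V) \<le> emeasure \<mu> W"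
        using openin_in_sets_borel_measures_on[OF \<mu> W(1)]
        by (auto simp: em intro: emeasure_mono)
    qed
    then have "(INF W\<in>{W. openin ?S W \<and> B \<subseteq> W}. emeasure ?\<nu> W)
        \<le> (INF W\<in>{W. openin T W \<and> B \<subseteq> W}. emeasure \<mu> W)"
      by (intro INF_greatest) auto
    also have "\<dots> = emeasure ?\<nu> B"
      using reg B by (simp add: regular_borel_measure_def sets_\<nu> em)
    finally show "(INF W\<in>{W. openin ?S W \<and> B \<subseteq> W}. emeasure ?\<nu> W) \<le> emeasure ?\<nu> B" .
  qed
  have inner: "emeasure ?\<nu> B
      = (SUP K\<in>{K. compactin ?S K \<and> K \<in> sets ?\<nu> \<and> K \<subseteq> B}. emeasure ?\<nu> K)"
    if B: "B \<in> sets ?\<nu>" for B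
  proof -
    \<comment> \<open>Compactness is intrinsic, so for B inside V both suprema range over the same
      sets.\<close>
    have "{K. compactin ?S K \<and> K \<in> sets ?\<nu> \<and> K \<subseteq> B} = {K. compactin T K \<and> K \<in> sets \<mu> \<and> K \<subseteq> B}"
      using B by (auto simp: compactin_subtopology sets_\<nu>)
    moreover have "emeasure \<mu> B = (SUP K\<in>{K. compactin T K \<and> K \<in> sets \<mu> \<and> K \<subseteq> B}. emeasure \<mu> K)"
      using reg B unfolding regular_borel_measure_def sets_\<nu> by blast
    ultimately show ?thesis
      using B by (auto simp: sets_\<nu> em intro!: SUP_cong)
  qed
  have "emeasure ?\<nu> K < \<infinity>" if "K \<in> sets ?\<nu>" "compactin ?S K" for K
  proof -
    have "emeasure \<mu> K < \<infinity>"
      using reg that unfolding regular_borel_measure_def sets_\<nu> compactin_subtopology by blast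
    then show ?thesis
      using that by (simp add: sets_\<nu> em)
  qed
  with outer inner restrict_space_borel_measures_on[OF \<mu> V] show ?thesis
    unfolding regular_borel_measure_def by blast
qed

lemma regular_borel_measures_subset: "regular_borel_measures X U \<subseteq> borel_measures X U"
  by (auto simp: regular_borel_measures_def borel_measures_def regular_borel_measure_def)

text \<open>V is also open in U, and the topology it inherits through U is the one it inherits from
  X.\<close>

lemma measure_res_borel_measures:
  assumes "openin X V" "V \<subseteq> U" "\<mu> \<in> borel_measures X U"
  shows "measure_res U V \<mu> \<in> borel_measures X V"
  using restrict_space_borel_measures_on[of \<mu> "subtopology X U" V] assms
  by (simp add: borel_measures_def measure_res_def subset_openin_subtopology
      subtopology_subtopology Int_absorb1)

lemma measure_res_regular_borel_measures:
  assumes "openin X V" "V \<subseteq> U" "\<mu> \<in> regular_borel_measures X U"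
  shows "measure_res U V \<mu> \<in> regular_borel_measures X V"
  using regular_borel_measure_restrict_space[of "subtopology X U" \<mu> V] assms
  by (simp add: regular_borel_measures_def measure_res_def subset_openin_subtopology
      subtopology_subtopology Int_absorb1)

lemma measure_res_self:
  assumes "openin X U" "\<mu> \<in> borel_measures X U"
  shows "measure_res U U \<mu> = \<mu>"
proof -
  \<comment> \<open>As U is open in X it lies in \<open>topspace X\<close>, so no points are lost in
    \<open>subtopology X U\<close>.\<close>
  have "space \<mu> = U"
    using assms space_borel_measures_on[of \<mu> "subtopology X U"] openin_subset[of X U]
    by (auto simp: borel_measures_def)
  then have "sets (measure_res U U \<mu>) = sets \<mu>"
    unfolding measure_res_def
    by (auto simp: sets_restrict_space_iff dest: sets.sets_into_space[THEN subsetD])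
  then show ?thesis
    using \<open>space \<mu> = U\<close> unfolding measure_res_def
    by (intro measure_eqI) (auto simp: emeasure_restrict_space dest: sets.sets_into_space)
qed

text \<open>Iterated restriction collapses to restriction to \<open>V \<inter> W\<close>, which is
  W; this uses that V and W are measurable, being open in U.\<close>

lemma measure_res_measure_res:
  assumes "openin X V" "openin X W" "W \<subseteq> V" "V \<subseteq> U" "\<mu> \<in> borel_measures X U"
  shows "measure_res V W (measure_res U V \<mu>) = measure_res U W \<mu>"
proof -
  have "V \<in> sets \<mu>" "W \<in> sets \<mu>"
    using assms
    by (auto simp: borel_measures_def
        intro!: openin_in_sets_borel_measures_on subset_openin_subtopology)
  then show ?thesis
    using assms(3) by (simp add: measure_res_def restrict_restrict_space Int_absorb1)
qed

lemma presheaf_borel_measures: "presheaf X (borel_measures X) measure_res"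
  by unfold_locales
    (auto intro: measure_res_borel_measures measure_res_self measure_res_measure_res)

text \<open>Only closure under restriction is specific to regular measures; identity and composition
  are inherited through the inclusion.\<close>

lemma presheaf_regular_borel_measures: "presheaf X (regular_borel_measures X) measure_res"
  using regular_borel_measures_subset[of X]
  by unfold_locales
    (auto intro: measure_res_regular_borel_measures measure_res_self measure_res_measure_res)

theorem lemma3p5:
  fixes X :: "'a topology"
  shows "sub_presheaf X (regular_borel_measures X) measure_res (borel_measures X) measure_res"
  by (intro sub_presheaf.intro sub_presheaf_axioms.intro presheaf_borel_measures
      presheaf_regular_borel_measures regular_borel_measures_subset refl)

end
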